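(* For every integer $n\geq 1$, neither of the circulant graphs $C_{18n-3}(1,6n)$ and $C_{18n+3}(1,6n)$ is edge-transitive.
   Context: For a positive integer $k$ and a list $L$ of positive integers, the circulant graph $C_k(L)$ is the simple undirected graph with vertices $v_1,\dots,v_k$ (indices taken modulo $k$) in which each $v_i$ is adjacent to $v_{i+j}$ and $v_{i-j}$ (indices mod $k$) for each $j\in L$. A graph is edge-transitive if its automorphism group acts transitively on its edge set. *)

theory Defs
  imports "HOL-Number_Theory.Cong" "HOL-Combinatorics.Permutations"
begin

record 'a ugraph =
  verts :: "'a set"
  edges :: "'a set set"

definition simple_graph :: "'a ugraph \<Rightarrow> bool" where
  "simple_graph G \<longleftrightarrow> (\<forall>e \<in> edges G. e \<subseteq> verts G \<and> card e = 2)"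

text \<open>Automorphisms are extended by the identity outside the vertex set
  (this is part of \<^const>\<open>permutes\<close>), so that they are determined by their action
  on the vertices.\<close>

definition automorphisms :: "'a ugraph \<Rightarrow> ('a \<Rightarrow> 'a) set" where
  "automorphisms G = {f. f permutes verts G \<and>
     (\<forall>u \<in> verts G. \<forall>v \<in> verts G. {f u, f v} \<in> edges G \<longleftrightarrow> {u, v} \<in> edges G)}"

definition edge_transitive :: "'a ugraph \<Rightarrow> bool" where
  "edge_transitive G \<longleftrightarrow>
     (\<forall>e \<in> edges G. \<forall>e' \<in> edges G. \<exists>f \<in> automorphisms G. f ` e = e')"

text \<open>The vertex \<open>v\<^sub>i\<close> is represented by its index \<open>i\<close> in \<open>{1..k}\<close>. The condition
  \<open>u \<noteq> v\<close> drops the loops that would arise from jumps divisible by \<open>k\<close>.\<close>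

definition circulant :: "nat \<Rightarrow> nat list \<Rightarrow> int ugraph" where
  "circulant k L =
     \<lparr> verts = {1..int k},
       edges = {{u, v} | u v. u \<in> {1..int k} \<and> v \<in> {1..int k} \<and> u \<noteq> v \<and>
         (\<exists>j \<in> set L. [v = u + int j] (mod int k) \<or> [v = u - int j] (mod int k))} \<rparr>"

lemma simple_graph_circulant: "simple_graph (circulant k L)"
  by (auto simp: simple_graph_def circulant_def card_insert_if)

end

theory Submission
  imports Defs
begin

text \<open>
  Two distinct neighbours \<open>u + p\<close>, \<open>u + q\<close> of a vertex \<open>u\<close> have the second common neighbour
  \<open>u + p + q\<close> unless \<open>p + q = 0\<close>. Conversely, \<open>u\<close> is the only common neighbour of \<open>u - 1\<close> and
  \<open>u + 1\<close>. Hence an automorphism maps the closed walk \<open>1, 2, 3, \<dots>\<close>, which visits all \<open>k\<close>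
  vertices, to a walk with constant step \<open>d\<close>. If the edge \<open>{1, 2}\<close> is mapped to \<open>{1, 1 + s}\<close>,
  then \<open>d = \<plusminus>s\<close>; but for \<open>s = 6n\<close> and \<open>k = 18n \<mp> 3\<close> the order of \<open>s\<close> modulo \<open>k\<close> divides
  \<open>k div 3\<close>, so injectivity fails.
\<close>

definition jump :: "int \<Rightarrow> int \<Rightarrow> int \<Rightarrow> bool" where
  "jump k s d \<longleftrightarrow> (\<exists>p \<in> {1, -1, s, -s}. [d = p] (mod k))"

lemma jump_cong: "[d = e] (mod k) \<Longrightarrow> jump k s d \<longleftrightarrow> jump k s e"
  unfolding jump_def by (meson cong_sym cong_trans)

lemma jump_uminus: "jump k s (- d) \<longleftrightarrow> jump k s d"
proof -
  have "jump k s (- d)" if "jump k s d" for d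
    using that unfolding jump_def by (force simp flip: cong_minus_minus_iff[of d])
  from this[of d] this[of "- d"] show ?thesis by auto
qed

text \<open>Since 1 < s < k, no jump is 0 modulo \<open>k\<close>, which accounts for the exclusion
  of loops. The jump set is closed under negation, so the order of the two ends does not
  matter.\<close>

lemma edges_circulant_iff_jump:
  assumes "1 < s" "s < k" "u \<in> {1..int k}" "v \<in> {1..int k}"
  shows "{u, v} \<in> edges (circulant k [1, s]) \<longleftrightarrow> jump (int k) (int s) (v - u)"
proof -
  have shift: "[y = x + p] (mod int k) \<longleftrightarrow> [y - x = p] (mod int k)"
    "[y = x - p] (mod int k) \<longleftrightarrow> [y - x = - p] (mod int k)" for x y p
    by (simp_all add: cong_iff_dvd_diff algebra_simps)
  have "{u, v} \<in> edges (circulant k [1, s]) \<longleftrightarrow>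
      u \<noteq> v \<and> (jump (int k) (int s) (v - u) \<or> jump (int k) (int s) (u - v))"
    using assms(3,4) by (auto simp: circulant_def doubleton_eq_iff jump_def shift)
  moreover have "\<not> jump (int k) (int s) 0"
    using assms(1,2) by (auto simp: jump_def cong_iff_dvd_diff dest: zdvd_imp_le)
  ultimately show ?thesis
    using jump_uminus[of "int k" "int s" "v - u"] by auto
qed

text \<open>The two jumps \<open>p\<close> and \<open>q\<close> satisfy p - q = 2 modulo
  \<open>k\<close>. As |p - q - 2| is at most 2s + 2 < k, this is an equality of integers, and s > 3
  leaves only p = 1, q = -1; for s = 3 also 3 - 1 = 2.\<close>

lemma common_neighbour_unique:
  assumes "3 < s" "2 * s + 2 < k" "jump k s (z - (u - 1))" "jump k s (z - (u + 1))"
  shows "[z = u] (mod k)"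
proof -
  from assms obtain p q where p: "p \<in> {1, -1, s, -s}" "[z - (u - 1) = p] (mod k)"
    and q: "q \<in> {1, -1, s, -s}" "[z - (u + 1) = q] (mod k)"
    unfolding jump_def by blast
  from cong_diff[OF p(2) q(2)] have "k dvd (p - q) - 2"
    by (simp add: cong_iff_dvd_diff dvd_diff_commute)
  moreover have "\<not> k dvd x" if "0 < x" "x < k" for x
    using that by (simp add: zdvd_not_zless)
  moreover have "\<not> k dvd x" if "0 < - x" "- x < k" for x
    using that zdvd_not_zless[of "- x" k] by simp
  ultimately have "p - q - 2 = 0 \<or> p - q - 2 \<ge> k \<or> p - q - 2 \<le> - k"
    by (smt (verit))
  then have "p = 1"
    using p(1) q(1) assms(1,2) by auto
  with p(2) show ?thesis by (simp add: cong_iff_dvd_diff)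
qed

text \<open>The fourth corner \<open>v + w - u\<close> of the parallelogram is again adjacent to
  \<open>v\<close> and \<open>w\<close>, so it must coincide with \<open>u\<close>.\<close>

lemma straight_if_common_neighbour_unique:
  assumes "jump k s (v - u)" "jump k s (w - u)"
    and "\<And>z. jump k s (z - v) \<Longrightarrow> jump k s (z - w) \<Longrightarrow> [z = u] (mod k)"
  shows "[v - u = u - w] (mod k)"
  using assms(3)[of "v + w - u"] assms(1,2) by (simp add: cong_iff_dvd_diff algebra_simps)

lemma cong_arith_progression:
  fixes g :: "nat \<Rightarrow> int"
  assumes "\<And>i. [g (i + 2) - g (i + 1) = g (i + 1) - g i] (mod k)"
  shows "[g i = g 0 + int i * (g 1 - g 0)] (mod k)"
proof -
  have step: "[g (Suc i) - g i = g 1 - g 0] (mod k)" for i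
    by (induction i) (use assms in \<open>auto intro: cong_trans\<close>)
  show ?thesis
  proof (induction i)
    case (Suc i)
    from cong_add[OF Suc step[of i]] show ?case
      by (simp add: algebra_simps)
  qed simp
qed

text \<open>The number \<open>m\<close> witnesses that \<open>s\<close> does not generate the
  integers modulo \<open>k\<close>: a walk with step s or -s is back at its start after
  \<open>m\<close> steps, while 1, 2, 3, ... is not.\<close>

theorem not_edge_transitive_circulant:
  fixes k s m :: nat
  assumes s: "3 < s" "2 * s + 2 < k" and m: "k dvd m * s" "\<not> k dvd m"
  shows "\<not> edge_transitive (circulant k [1, s])"
proof
  let ?G = "circulant k [1, s]" and ?V = "{1..int k}"
  let ?J = "jump (int k) (int s)"
  assume "edge_transitive ?G"
  moreover have "{1, 2} \<in> edges ?G" "{1, 1 + int s} \<in> edges ?G"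
    using s by (subst edges_circulant_iff_jump; simp add: jump_def)+
  ultimately obtain f where f: "f \<in> automorphisms ?G" and image: "f ` {1, 2} = {1, 1 + int s}"
    unfolding edge_transitive_def by blast
  have verts: "verts ?G = ?V"
    by (simp add: circulant_def)
  with f have perm: "f permutes ?V"
    by (simp add: automorphisms_def)
  have f_jump: "?J (f v - f u) \<longleftrightarrow> ?J (v - u)" if "u \<in> ?V" "v \<in> ?V" for u v
  proof -
    from that have "f u \<in> ?V" "f v \<in> ?V"
      by (simp_all only: permutes_in_image[OF perm])
    moreover have "{f u, f v} \<in> edges ?G \<longleftrightarrow> {u, v} \<in> edges ?G"
      using f that unfolding automorphisms_def verts by blast
    ultimately show ?thesis
      using that s by (simp add: edges_circulant_iff_jump del: One_nat_def)
  qed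
  \<comment> \<open>\<open>r\<close> picks the representative in 1..k, hence the shift by 1. It
    makes \<open>g\<close> a k-periodic extension of \<open>f\<close> to all integers, so walks may
    run past \<open>k\<close>.\<close>
  define r where "r i = (i - 1) mod int k + 1" for i
  have r_in: "r i \<in> ?V" for i
    using s by (simp add: r_def add1_zle_eq)
  have r_cong: "[r i = i] (mod int k)" for i
    unfolding r_def by (simp add: cong_def mod_add_left_eq)
  have r_id: "r i = i" if "i \<in> ?V" for i
    using that by (simp add: r_def)
  define g where "g i = f (r i)" for i
  have g_jump: "?J (g j - g i) \<longleftrightarrow> ?J (j - i)" for i j
    using f_jump[OF r_in r_in] jump_cong[OF cong_diff[OF r_cong r_cong]]
    by (simp add: g_def)
  have straight: "[g (i + 1) - g i = g i - g (i - 1)] (mod int k)" for i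
  proof (rule straight_if_common_neighbour_unique[of _ "int s"])
    show "?J (g (i + 1) - g i)" "?J (g (i - 1) - g i)"
      unfolding g_jump by (simp_all add: jump_def)
    fix z assume z: "?J (z - g (i + 1))" "?J (z - g (i - 1))"
    \<comment> \<open>Surjectivity of \<open>f\<close> pulls \<open>z\<close> back to a common
      neighbour of \<open>i + 1\<close> and \<open>i - 1\<close>, which can only be
      \<open>i\<close>.\<close>
    obtain x where x: "x \<in> ?V" "f x = r z"
      using perm r_in[of z] by (metis imageE permutes_image)
    then have "[g x = z] (mod int k)"
      using r_cong[of z] r_id by (simp add: g_def)
    then have "?J (g x - g (i + 1))" "?J (g x - g (i - 1))"
      using z jump_cong[OF cong_diff[OF _ cong_refl]] by blast+
    then have "[x = i] (mod int k)"
      unfolding g_jump using common_neighbour_unique[of "int s" "int k"] s by auto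
    then have "g x = g i"
      using cong_diff[of x i "int k" 1 1] by (simp add: g_def r_def cong_def)
    with \<open>[g x = z] (mod int k)\<close> show "[z = g i] (mod int k)"
      by (simp add: cong_sym)
  qed
  \<comment> \<open>The walk starts at 1 rather than 0, so that its first step is the edge {1, 2}
    with known image.\<close>
  have "[g (int m + 1) = g 1 + int m * (g 2 - g 1)] (mod int k)"
  proof -
    have "[g (int (i + 2) + 1) - g (int (i + 1) + 1) = g (int (i + 1) + 1) - g (int i + 1)]
        (mod int k)" for i
      using straight[of "int i + 2"] by (simp add: algebra_simps)
    from cong_arith_progression[of "\<lambda>i. g (int i + 1)", OF this, of m] show ?thesis
      by simp
  qed
  moreover have "int k dvd int m * (g 2 - g 1)"
  proof -
    have "int k dvd int m * int s"
      using m(1) by (metis of_nat_dvd_iff of_nat_mult)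
    \<comment> \<open>The sign depends on which end of {1, 1 + s} is the image of 1.\<close>
    moreover have "g 2 - g 1 = int s \<or> g 2 - g 1 = - int s"
      using image s by (auto simp: g_def r_id doubleton_eq_iff)
    ultimately show ?thesis by auto
  qed
  ultimately have "[g (int m + 1) = g 1] (mod int k)"
    by (metis cong_add_lcancel_0 cong_0_iff cong_trans)
  moreover have "g i \<in> ?V" for i
    unfolding g_def by (simp only: permutes_in_image[OF perm] r_in)
  ultimately have "g (int m + 1) = g 1"
    using r_id by (metis cong_def cong_diff cong_refl r_def)
  then have "r (int m + 1) = r 1"
    using permutes_inj[OF perm] by (simp add: g_def inj_eq)
  then have "k dvd m"
    by (simp add: r_def mod_eq_0_iff_dvd)
  with m(2) show False ..
qed

theorem theorem2p2:
  fixes n :: nat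
  assumes "n \<ge> 1"
  shows "\<not> edge_transitive (circulant (18 * n - 3) [1, 6 * n])
       \<and> \<not> edge_transitive (circulant (18 * n + 3) [1, 6 * n])"
proof
  have k: "18 * n - 3 = 3 * (6 * n - 1)" "18 * n + 3 = 3 * (6 * n + 1)" by simp_all
  \<comment> \<open>Here \<open>m\<close> stands for a third of the number of vertices; the other
    factor 3 comes from 6n.\<close>
  have dvd: "3 * m dvd m * (6 * n)" for m
    by (rule dvdI[of _ _ "2 * n"]) simp
  show "\<not> edge_transitive (circulant (18 * n - 3) [1, 6 * n])"
  proof (rule not_edge_transitive_circulant)
    show "18 * n - 3 dvd (6 * n - 1) * (6 * n)" unfolding k by (rule dvd)
    show "\<not> 18 * n - 3 dvd 6 * n - 1" using assms by (auto dest: dvd_imp_le)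
  \<comment> \<open>The bound 2s + 2 < k is tight for n = 1, where it reads 14 < 15.\<close>
  qed (use assms in auto)
  show "\<not> edge_transitive (circulant (18 * n + 3) [1, 6 * n])"
  proof (rule not_edge_transitive_circulant)
    show "18 * n + 3 dvd (6 * n + 1) * (6 * n)" unfolding k by (rule dvd)
    show "\<not> 18 * n + 3 dvd 6 * n + 1" by (auto dest: dvd_imp_le)
  qed (use assms in auto)
qed

end
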